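(* Suppose that Assumption 1 and Assumption 2(ii) (both stated in the context) hold, let $\{(x^k,y^k,z^k)\}_{k\ge0}$ be a sequence generated by the PL-ADMM algorithm converging to $(x^\infty,y^\infty,z^\infty)$, and suppose $\mathcal R$ satisfies the Kurdyka-Łojasiewicz property at $v^\infty:=(x^\infty,y^\infty,z^\infty,y^\infty,z^\infty)$ with an exponent, that is, there exist $\theta\in[0,1)$, $C_L>0$ and $\epsilon>0$ such that for all $v=(x,y,z,y',z')$ with ${\rm dist}(v,v^\infty)<\epsilon$, $$|\mathcal R(v)-\mathcal R(v^\infty)|^{\theta}\le C_L\,{\rm dist}(0,\partial\mathcal R(v)).$$ Let $\mathcal E_k:=\mathcal R_k-\mathcal R_\infty$, where $\mathcal R_\infty:=\mathcal R(v^\infty)=\lim_{k\to\infty}\mathcal R_k$. Then there exist $K\ge1$ and $\bar\alpha>0$ such that $$\bar\alpha\,\mathcal E_k^{2\theta}\le\mathcal E_{k-1}-\mathcal E_k\qquad\text{for all }k\ge K.$$ Moreover: (a) if $\theta=0$, then $\mathcal E_k$ converges to zero in a finite number of iterations; (b) if $\theta\in(0,1/2]$, then for all $k\ge K$, $$\mathcal E_k\le\frac{\max\{\mathcal E_i:1\le i\le K\}}{(1+\bar\alpha\,\mathcal E_K^{2\theta-1})^{k-K+1}};$$ (c) if $\theta\in(1/2,1)$, then there is $\mu>0$ such that for all $k\ge K$, $$\mathcal E_k\le\Big(\frac{1}{\mu(k-K)+\mathcal E_K^{1-2\theta}}\Big)^{\frac{1}{2\theta-1}}.$$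
   Context: Setting. $A\in\mathbb R^{p\times n}$, $B\in\mathbb R^{p\times m}$, $c\in\mathbb R^p$; $A^*,B^*$ are the transposes; $\|\cdot\|$ is the Euclidean norm (operator norm for matrices); $\|v\|_Q^2=\langle v,Qv\rangle$ for symmetric $Q$. $\partial$ is the limiting (Mordukhovich) subdifferential; ${\rm dist}(x,S)=\inf_{s\in S}\|x-s\|$, equal to $+\infty$ if $S=\emptyset$. $f:\mathbb R^n\to\mathbb R\cup\{+\infty\}$ is proper; $g:\mathbb R^n\to\mathbb R$ and $h:\mathbb R^m\to\mathbb R$ are differentiable; none is assumed convex. The problem is $\min_{x,y} f(x)+g(x)+h(y)$ subject to $Ax+By+c=0$. For $\alpha>0$, $\mathcal L^{\alpha}(x,y,z)=f(x)+g(x)+h(y)+\langle z,Ax+By+c\rangle+\frac{\alpha}{2}\|Ax+By+c\|^2$, $z\in\mathbb R^p$. Conventions: $0^0=0$ in the inequalities with $\theta=0$; if $\mathcal E_K=0$ (in which case $\mathcal E_k=0$ for all $k\ge K$) the bounds in (b), (c) are read as $\mathcal E_k=0$. PL-ADMM algorithm. Given symmetric positive semidefinite matrices $Q_1^k\in\mathbb R^{n\times n}$, $Q_2^k\in\mathbb R^{m\times m}$ ($k\ge0$) and $(x^0,y^0,z^0)$, for $k\ge 0$: $x^{k+1}\in\arg\min_x\{ f(x)+\langle\nabla g(x^k)+\alpha A^*(Ax^k+By^k+c+\alpha^{-1}z^k),x-x^k\rangle+\frac12\|x-x^k\|^2_{Q_1^k}\}$, $y^{k+1}=\arg\min_y\{\langle\nabla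 h(y^k)+B^*z^k,y-y^k\rangle+\frac{\alpha}{2}\|By+Ax^{k+1}+c\|^2+\frac12\|y-y^k\|^2_{Q_2^k}\}$, $z^{k+1}=z^k+\alpha\beta(Ax^{k+1}+By^{k+1}+c)$. Write $\Delta u^{k}=u^{k}-u^{k-1}$ for $k\ge1$. Assumption 1. (A1) $f$ is lower semicontinuous and coercive; (A2) $g$ is coercive and $h$ is bounded from below; (A3) $B$ has full column rank (so $B^*B$ is invertible), ${\rm Im}(A)\subseteq{\rm Im}(B)$ and $c\in{\rm Im}(B)$; (A4) $\nabla g$ and $\nabla h$ are Lipschitz continuous with constants $L_g$ and $L_h$; (A5) $\alpha>0$, $\beta\in(0,2)$, $q_i^-:=\inf_{k\ge0}\|Q_i^k\|\ge0$ and $q_i:=\sup_{k\ge0}\|Q_i^k\|<+\infty$, $i=1,2$. Constants. $\lambda_{\max}^{X}$ and $\lambda_+^{X}$ are the largest and the smallest positive eigenvalue of $X$. $\theta_0=\frac{2\beta(L_h+q_2)^2}{\alpha\lambda_+^{B^*B}(1-|1-\beta|)^2}$, $\theta_1=\frac{2\beta q_2^2}{\alpha\lambda_+^{B^*B}(1-|1-\beta|)^2}$, $\gamma_0=\frac{|1-\beta|}{\alpha\beta\lambda_+^{B^*B}(1-|1-\beta|)}$. For a fixed $r>1$, $\mathcal R(x,y,z,y',z')=\mathcal L^\alpha(x,y,z)+r\gamma_0\|B^*(z-z')\|^2+r\theta_0\|y-y'\|^2$ and $\mathcal R_k=\mathcal R(x^k,y^k,z^k,y^{k-1},z^{k-1})$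 for $k\ge1$. Assumption 2(ii) (relaxed sufficient decrease condition). The parameters $\alpha>0$, $\beta\in(0,2)$, $r>1$ and the matrices $Q_1^k,Q_2^k$ are such that for some $k_0\ge1$ and $\sigma>0$, $\inf_{k\ge k_0}\{\|Q_1^k\|-\alpha\lambda_{\max}^{A^*A}-L_g,\ \|Q_2^k\|+\alpha\lambda_+^{B^*B}-(L_h+r\theta_0+r\theta_1),\ \frac{r-1}{\alpha\beta}\}>\sigma$, and with this the sufficient decrease inequality $\mathcal R_{k+1}+\sigma(\|\Delta x^{k+1}\|^2+\|\Delta y^{k+1}\|^2+\|\Delta z^{k+1}\|^2)\le\mathcal R_k\le\mathcal R_{k_0}$ holds for all $k\ge k_0$. *)

theory Defs
  imports "HOL-Analysis.Analysis"
begin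

text \<open>
  Extended-real-valued functions have type \<open>_ \<Rightarrow> ereal\<close>; matrices act on vectors by \<open>*v\<close>.
  The instance norm of a matrix type is the Frobenius norm, so the operator norm has to be taken as
  \<open>onorm ((*v) Q)\<close>.
\<close>

abbreviation opnorm :: "real^'a^'b \<Rightarrow> real" where
  "opnorm Q \<equiv> onorm ((*v) Q)"

definition grad :: "('a::real_inner \<Rightarrow> real) \<Rightarrow> 'a \<Rightarrow> 'a" where
  "grad g x = (THE D. GDERIV g x :> D)"

definition proper :: "('a \<Rightarrow> ereal) \<Rightarrow> bool" where
  "proper F \<longleftrightarrow> (\<forall>x. F x \<noteq> -\<infinity>) \<and> (\<exists>x. F x \<noteq> \<infinity>)"

definition lower_semicontinuous :: "('a::topological_space \<Rightarrow> ereal) \<Rightarrow> bool" where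
  "lower_semicontinuous F \<longleftrightarrow> (\<forall>x. F x \<le> Liminf (at x) F)"

definition coercive :: "('a::real_normed_vector \<Rightarrow> ereal) \<Rightarrow> bool" where
  "coercive F \<longleftrightarrow> (F \<longlongrightarrow> \<infinity>) at_infinity"

definition argmin_set :: "('a \<Rightarrow> 'b::ord) \<Rightarrow> 'a set" where
  "argmin_set F = {u. is_arg_min F (\<lambda>_. True) u}"

definition frechet_subdiff :: "('a::euclidean_space \<Rightarrow> ereal) \<Rightarrow> 'a \<Rightarrow> 'a set" where
  "frechet_subdiff F x =
     {v. \<bar>F x\<bar> \<noteq> \<infinity> \<and>
         0 \<le> Liminf (at x) (\<lambda>u. (F u - F x - ereal (v \<bullet> (u - x))) / ereal (norm (u - x)))}"

text \<open>The limiting (Mordukhovich) subdifferential; empty outside the domain of \<open>F\<close>.\<close>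

definition limiting_subdiff :: "('a::euclidean_space \<Rightarrow> ereal) \<Rightarrow> 'a \<Rightarrow> 'a set" where
  "limiting_subdiff F x =
     {v. \<bar>F x\<bar> \<noteq> \<infinity> \<and>
         (\<exists>xs vs. xs \<longlonglongrightarrow> x \<and> (\<lambda>j. F (xs j)) \<longlonglongrightarrow> F x \<and>
                  (\<forall>j. vs j \<in> frechet_subdiff F (xs j)) \<and> vs \<longlonglongrightarrow> v)}"

text \<open>Unlike \<open>infdist\<close>, the distance to the empty set is \<open>\<infinity>\<close>.\<close>

definition dist_set :: "'a::real_normed_vector \<Rightarrow> 'a set \<Rightarrow> ereal" where
  "dist_set x S = (INF s\<in>S. ereal (norm (x - s)))"

text \<open>
  Powers of nonnegative extended reals. Since \<open>0 powr 0 = 0\<close>, the convention \<open>0\<^sup>0 = 0\<close> is built in,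
  both here and wherever \<open>powr\<close> is used with a possibly vanishing exponent.
\<close>

definition ereal_powr :: "ereal \<Rightarrow> real \<Rightarrow> ereal" where
  "ereal_powr e a =
     (if e = \<infinity> then (if a = 0 then 1 else \<infinity>) else ereal (real_of_ereal e powr a))"

definition KL_with_exponent :: "('a::euclidean_space \<Rightarrow> ereal) \<Rightarrow> 'a \<Rightarrow> real \<Rightarrow> bool" where
  "KL_with_exponent F v0 \<theta> \<longleftrightarrow>
     0 \<le> \<theta> \<and> \<theta> < 1 \<and>
     (\<exists>C\<^sub>L>0. \<exists>\<epsilon>>0. \<forall>v. dist v v0 < \<epsilon> \<longrightarrow>
        ereal_powr \<bar>F v - F v0\<bar> \<theta> \<le> ereal C\<^sub>L * dist_set 0 (limiting_subdiff F v))"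

definition sym_psd :: "real^'a^'a \<Rightarrow> bool" where
  "sym_psd Q \<longleftrightarrow> transpose Q = Q \<and> (\<forall>v. 0 \<le> v \<bullet> (Q *v v))"

definition eigenvalues :: "real^'a^'a \<Rightarrow> real set" where
  "eigenvalues X = {l. \<exists>v. v \<noteq> 0 \<and> X *v v = l *\<^sub>R v}"

definition lambda_max :: "real^'a^'a \<Rightarrow> real" where
  "lambda_max X = Max (eigenvalues X)"

definition lambda_plus :: "real^'a^'a \<Rightarrow> real" where
  "lambda_plus X = Min {l \<in> eigenvalues X. 0 < l}"

definition aug_lagrangian ::
  "(real^'n \<Rightarrow> ereal) \<Rightarrow> (real^'n \<Rightarrow> real) \<Rightarrow> (real^'m \<Rightarrow> real) \<Rightarrow>
   real^'n^'p \<Rightarrow> real^'m^'p \<Rightarrow> real^'p \<Rightarrow> real \<Rightarrow>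
   real^'n \<Rightarrow> real^'m \<Rightarrow> real^'p \<Rightarrow> ereal" where
  "aug_lagrangian f g h A B c \<alpha> x y z =
     f x + ereal (g x + h y + z \<bullet> (A *v x + B *v y + c)
                  + \<alpha> / 2 * (norm (A *v x + B *v y + c))\<^sup>2)"

definition merit ::
  "(real^'n \<Rightarrow> ereal) \<Rightarrow> (real^'n \<Rightarrow> real) \<Rightarrow> (real^'m \<Rightarrow> real) \<Rightarrow>
   real^'n^'p \<Rightarrow> real^'m^'p \<Rightarrow> real^'p \<Rightarrow> real \<Rightarrow> real \<Rightarrow> real \<Rightarrow> real \<Rightarrow>
   (real^'n) \<times> (real^'m) \<times> (real^'p) \<times> (real^'m) \<times> (real^'p) \<Rightarrow> ereal" where
  "merit f g h A B c \<alpha> r \<gamma>\<^sub>0 \<theta>\<^sub>0 = (\<lambda>(x, y, z, y', z').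
     aug_lagrangian f g h A B c \<alpha> x y z
     + ereal (r * \<gamma>\<^sub>0 * (norm (transpose B *v (z - z')))\<^sup>2 + r * \<theta>\<^sub>0 * (norm (y - y'))\<^sup>2))"

definition pl_admm ::
  "(real^'n \<Rightarrow> ereal) \<Rightarrow> (real^'n \<Rightarrow> real) \<Rightarrow> (real^'m \<Rightarrow> real) \<Rightarrow>
   real^'n^'p \<Rightarrow> real^'m^'p \<Rightarrow> real^'p \<Rightarrow> real \<Rightarrow> real \<Rightarrow>
   (nat \<Rightarrow> real^'n^'n) \<Rightarrow> (nat \<Rightarrow> real^'m^'m) \<Rightarrow>
   (nat \<Rightarrow> real^'n) \<Rightarrow> (nat \<Rightarrow> real^'m) \<Rightarrow> (nat \<Rightarrow> real^'p) \<Rightarrow> bool" where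
  "pl_admm f g h A B c \<alpha> \<beta> Q\<^sub>1 Q\<^sub>2 x y z \<longleftrightarrow>
     (\<forall>k. sym_psd (Q\<^sub>1 k) \<and> sym_psd (Q\<^sub>2 k)) \<and>
     (\<forall>k. x (Suc k) \<in> argmin_set (\<lambda>u. f u + ereal (
            (grad g (x k)
              + \<alpha> *\<^sub>R (transpose A *v (A *v x k + B *v y k + c + (1 / \<alpha>) *\<^sub>R z k))) \<bullet> (u - x k)
            + 1 / 2 * ((u - x k) \<bullet> (Q\<^sub>1 k *v (u - x k)))))) \<and>
     (\<forall>k. argmin_set (\<lambda>u.
            (grad h (y k) + transpose B *v z k) \<bullet> (u - y k)
            + \<alpha> / 2 * (norm (B *v u + A *v x (Suc k) + c))\<^sup>2
            + 1 / 2 * ((u - y k) \<bullet> (Q\<^sub>2 k *v (u - y k)))) = {y (Suc k)}) \<and>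
     (\<forall>k. z (Suc k) = z k + (\<alpha> * \<beta>) *\<^sub>R (A *v x (Suc k) + B *v y (Suc k) + c))"

text \<open>
  The relaxed sufficient decrease condition comprises both the parameter bound and the decrease of
  the merit values \<open>Rk\<close>, with the same \<open>k\<^sub>0\<close> and \<open>\<sigma>\<close>: the bound on the norms of \<open>Q\<^sub>1 k\<close>, \<open>Q\<^sub>2 k\<close>
  alone does not give the decrease.
\<close>

definition relaxed_sufficient_decrease ::
  "real^'n^'p \<Rightarrow> real^'m^'p \<Rightarrow> real \<Rightarrow> real \<Rightarrow> real \<Rightarrow> real \<Rightarrow> real \<Rightarrow> real \<Rightarrow> real \<Rightarrow>
   (nat \<Rightarrow> real^'n^'n) \<Rightarrow> (nat \<Rightarrow> real^'m^'m) \<Rightarrow>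
   (nat \<Rightarrow> real^'n) \<Rightarrow> (nat \<Rightarrow> real^'m) \<Rightarrow> (nat \<Rightarrow> real^'p) \<Rightarrow> (nat \<Rightarrow> ereal) \<Rightarrow> bool" where
  "relaxed_sufficient_decrease A B \<alpha> \<beta> L\<^sub>g L\<^sub>h r \<theta>\<^sub>0 \<theta>\<^sub>1 Q\<^sub>1 Q\<^sub>2 x y z Rk \<longleftrightarrow>
     (\<exists>k\<^sub>0\<ge>1. \<exists>\<sigma>>0.
        \<sigma> < Inf (\<Union>k\<in>{k\<^sub>0..}.
              {opnorm (Q\<^sub>1 k) - \<alpha> * lambda_max (transpose A ** A) - L\<^sub>g,
               opnorm (Q\<^sub>2 k) + \<alpha> * lambda_plus (transpose B ** B) - (L\<^sub>h + r * \<theta>\<^sub>0 + r * \<theta>\<^sub>1),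
               (r - 1) / (\<alpha> * \<beta>)}) \<and>
        (\<forall>k\<ge>k\<^sub>0.
           Rk (Suc k) + ereal (\<sigma> * ((norm (x (Suc k) - x k))\<^sup>2 + (norm (y (Suc k) - y k))\<^sup>2
                                      + (norm (z (Suc k) - z k))\<^sup>2)) \<le> Rk k \<and>
           Rk k \<le> Rk k\<^sub>0))"

end

theory Submission
  imports Defs
begin

text \<open>
  Each iterate minimises a proximal model of \<open>f\<close> resp. of the \<open>y\<close>-part, which yields a subgradient of
  the merit function at \<open>(x\<^sup>k, y\<^sup>k, z\<^sup>k, y\<^sup>k\<^sup>-\<^sup>1, z\<^sup>k\<^sup>-\<^sup>1)\<close> whose norm is at most a constant times the
  last step length. Combined with the Lojasiewicz inequality and the sufficient decrease (quadratic
  in the step length) this gives the recursion \<open>a * E k powr (2 * \<theta>) \<le> E (k - 1) - E k\<close>, and the three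
  regimes of \<open>\<theta>\<close> are read off from it. That the merit values converge to the value at the limit
  follows from lower semicontinuity of \<open>f\<close> and from comparing each \<open>x\<close>-step with the competitor
  \<open>xinf\<close>.
\<close>

section \<open>Gradients, subgradients and lower semicontinuity\<close>

text \<open>Since \<open>grad\<close> is a definite description, both existence and uniqueness of
  the gradient have to be shown. Existence is the Riesz representation of the derivative through its
  values on an orthonormal basis; uniqueness is that of the derivative.\<close>

lemma has_gderiv_grad:
  fixes g :: "'a::euclidean_space \<Rightarrow> real"
  assumes "g differentiable (at u)"
  shows "GDERIV g u :> grad g u"
proof -
  obtain D where D: "(g has_derivative D) (at u)"
    using assms by (auto simp: differentiable_def)
  define w where "w = (\<Sum>b\<in>Basis. D b *\<^sub>R b)"
  have "D h = h \<bullet> w" for h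
  proof -
    have lin: "linear D" using D has_derivative_linear by blast
    have "D h = D (\<Sum>b\<in>Basis. (h \<bullet> b) *\<^sub>R b)" by (simp add: euclidean_representation)
    also have "\<dots> = h \<bullet> w"
      using lin by (simp add: w_def linear_sum linear_cmul inner_sum_right mult.commute o_def)
    finally show ?thesis .
  qed
  then have "D = (\<lambda>h. h \<bullet> w)" by auto
  with D have w: "GDERIV g u :> w" by (simp add: gderiv_def)
  have "D' = w" if "GDERIV g u :> D'" for D'
  proof -
    have "(\<lambda>h. h \<bullet> D') = (\<lambda>h. h \<bullet> w)"
      using that w unfolding gderiv_def by (rule has_derivative_unique)
    then have "\<forall>h. h \<bullet> D' = h \<bullet> w" by (simp add: fun_eq_iff)
    then show ?thesis by (simp only: vector_eq_ldot)
  qed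
  with w show ?thesis unfolding grad_def by (rule theI)
qed

text \<open>Up to a constant, \<open>G\<close> touches \<open>F\<close> from below at
  \<open>v\<close>, so the difference quotient of \<open>F\<close> dominates the first-order
  remainder quotient of \<open>G\<close>, whose limit at \<open>v\<close> is 0.\<close>

lemma frechet_subdiffI:
  fixes F :: "'a::euclidean_space \<Rightarrow> ereal"
  assumes fin: "\<bar>F v\<bar> \<noteq> \<infinity>" and G: "GDERIV G v :> w"
    and le: "\<And>u. F v + ereal (G u - G v) \<le> F u"
  shows "w \<in> frechet_subdiff F v"
proof -
  let ?q = "\<lambda>u. (1 / norm (u - v)) *\<^sub>R (G u - (G v + (u - v) \<bullet> w))"
  have "(?q \<longlongrightarrow> 0) (at v)"
    using G unfolding gderiv_def has_derivative_within by auto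
  then have "((\<lambda>u. ereal (?q u)) \<longlongrightarrow> ereal 0) (at v)"
    by (rule tendsto_ereal)
  then have "Liminf (at v) (\<lambda>u. ereal (?q u)) = 0"
    by (intro lim_imp_Liminf) (auto simp: zero_ereal_def)
  moreover have "ereal (?q u) \<le> (F u - F v - ereal (w \<bullet> (u - v))) / ereal (norm (u - v))"
    if "u \<noteq> v" for u
  proof -
    obtain a where a: "F v = ereal a" using fin by (cases "F v") auto
    show ?thesis
    proof (cases "F u")
      case (real b)
      have "G u - G v \<le> b - a" using le[of u] a real by simp
      then show ?thesis using that
        by (simp add: a real inner_commute divide_simps)
    next
      case PInf then show ?thesis using that a by (simp add: divide_ereal_def)
    next
      case MInf then show ?thesis using le[of u] a by simp
    qed
  qed
  then have "Liminf (at v) (\<lambda>u. ereal (?q u)) \<le>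
      Liminf (at v) (\<lambda>u. (F u - F v - ereal (w \<bullet> (u - v))) / ereal (norm (u - v)))"
    by (intro Liminf_mono) (auto simp: eventually_at_filter)
  ultimately show ?thesis using fin by (simp add: frechet_subdiff_def)
qed

lemma frechet_subset_limiting: "frechet_subdiff F v \<subseteq> limiting_subdiff F v"
proof
  fix w assume w: "w \<in> frechet_subdiff F v"
  then show "w \<in> limiting_subdiff F v"
    unfolding limiting_subdiff_def mem_Collect_eq
    by (intro conjI exI[of _ "\<lambda>_. v"] exI[of _ "\<lambda>_. w"]) (auto simp: frechet_subdiff_def)
qed

lemma dist_set_zero_le: "w \<in> S \<Longrightarrow> dist_set 0 S \<le> ereal (norm w)"
  unfolding dist_set_def by (rule INF_lower2[of w]) auto

lemma lsc_eventually_less: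
  assumes "lower_semicontinuous F" and "a < F l" and "X \<longlonglongrightarrow> l"
  shows "\<forall>\<^sub>F k in sequentially. a < F (X k)"
proof -
  have "a < Liminf (at l) F"
    using assms(1,2) unfolding lower_semicontinuous_def by (meson less_le_trans)
  then have "\<forall>\<^sub>F u in at l. a < F u" by (rule less_LiminfD)
  \<comment> \<open>The filter \<open>at l\<close> omits the point \<open>l\<close> itself, which
    the sequence may visit; the hypothesis \<open>a < F l\<close> supplies it.\<close>
  then have "\<forall>\<^sub>F u in nhds l. a < F u"
    using assms(2) by (auto simp: eventually_at_filter elim: eventually_mono)
  then show ?thesis using assms(3) by (rule eventually_compose_filterlim)
qed

section \<open>Convergence rates from the decrease recursion\<close>

text \<open>As \<open>0 powr 0 = 0\<close>, the left side of the recursion is \<open>a\<close> when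
  \<open>E k\<close> is nonzero and 0 otherwise. A nonzero value thus costs a drop of at least
  \<open>a\<close>, which is impossible once the drops, tending to 0, fall below
  \<open>a\<close>.\<close>

lemma finite_termination_of_decrease:
  fixes E :: "nat \<Rightarrow> real"
  assumes a: "a > 0" and dec: "\<And>k. k \<ge> K \<Longrightarrow> a * E k powr 0 \<le> E (k - 1) - E k"
    and lim: "E \<longlonglongrightarrow> 0"
  shows "\<exists>N. \<forall>k\<ge>N. E k = 0"
proof -
  have "(\<lambda>k. E k - E (Suc k)) \<longlonglongrightarrow> 0 - 0"
    by (intro tendsto_diff lim LIMSEQ_Suc)
  then have "\<forall>\<^sub>F k in sequentially. E k - E (Suc k) < a"
    using a by (intro order_tendstoD(2)) auto
  then obtain N where N: "\<And>k. k \<ge> N \<Longrightarrow> E k - E (Suc k) < a"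
    by (auto simp: eventually_sequentially)
  have "E k = 0" if "k \<ge> Suc (max N K)" for k
  proof (rule ccontr)
    assume "E k \<noteq> 0"
    then have "a \<le> E (k - 1) - E k" using dec[of k] that by simp
    then show False using N[of "k - 1"] that by (cases k) auto
  qed
  then show ?thesis by blast
qed

text \<open>For \<theta> at most 1/2 the exponent \<open>2 * \<theta> - 1\<close> is not positive,
  so \<open>E k \<le> E K\<close> bounds \<open>E k powr (2 * \<theta> - 1)\<close> from below and
  the recursion becomes a contraction by a fixed factor. It already applies at index
  \<open>K\<close>, which is why the bound starts from \<open>E (K - 1)\<close> and has
  \<open>k - K + 1\<close> factors.\<close>

lemma linear_rate_of_decrease:
  fixes E :: "nat \<Rightarrow> real"
  assumes a: "a > 0" and \<theta>: "\<theta> \<le> 1 / 2"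
    and nonneg: "\<And>k. k \<ge> K \<Longrightarrow> 0 \<le> E k" and pos: "0 < E K"
    and dec: "\<And>k. k \<ge> K \<Longrightarrow> a * E k powr (2 * \<theta>) \<le> E (k - 1) - E k"
    and k: "k \<ge> K" and K: "K \<ge> 1"
  shows "E k \<le> E (K - 1) / (1 + a * E K powr (2 * \<theta> - 1)) ^ (k - K + 1)"
proof -
  define q where "q = 1 + a * E K powr (2 * \<theta> - 1)"
  have q: "q > 1" using a pos by (simp add: q_def)
  have anti: "E k \<le> E (k - 1)" if "k \<ge> K" for k
  proof -
    have "0 \<le> a * E k powr (2 * \<theta>)" using a by simp
    with dec[OF that] show ?thesis by linarith
  qed
  have le: "E k \<le> E K" if "k \<ge> K" for k
    using that
  proof (induction rule: dec_induct)
    case (step n) then show ?case using anti[of "Suc n"] by simp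
  qed simp
  have step: "q * E k \<le> E (k - 1)" if k: "k \<ge> K" for k
  \<comment> \<open>\<open>0 powr (2 * \<theta> - 1)\<close> is 0, so the comparison of powers below
    would fail at a zero value.\<close>
  proof (cases "E k = 0")
    case True then show ?thesis using anti[OF k] by simp
  next
    case False
    with nonneg[OF k] have Ek: "E k > 0" by simp
    have "E K powr (2 * \<theta> - 1) \<le> E k powr (2 * \<theta> - 1)"
      using \<theta> Ek le[OF k] by (intro powr_mono2') auto
    then have "a * (E K powr (2 * \<theta> - 1) * E k) \<le> a * (E k powr (2 * \<theta> - 1) * E k)"
      using a Ek by simp
    also have "E k powr (2 * \<theta> - 1) * E k = E k powr (2 * \<theta>)"
      using Ek by (simp add: powr_diff)
    finally show ?thesis using dec[OF k] by (simp add: q_def algebra_simps)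
  qed
  have "q ^ (k - K + 1) * E k \<le> E (K - 1)"
    using k
  proof (induction rule: dec_induct)
    case base then show ?case using step[of K] by simp
  next
    case (step n)
    have "q ^ (Suc n - K + 1) * E (Suc n) = q ^ (n - K + 1) * (q * E (Suc n))"
      using step.hyps by (simp add: Suc_diff_le)
    also have "\<dots> \<le> q ^ (n - K + 1) * E n"
      using \<open>\<And>k. k \<ge> K \<Longrightarrow> q * E k \<le> E (k - 1)\<close>[of "Suc n"] step.hyps q
      by (intro mult_left_mono) auto
    finally show ?case using step.IH by linarith
  qed
  then show ?thesis using q unfolding q_def[symmetric] by (simp add: field_simps)
qed

text \<open>Discrete counterpart of integrating u' \<le> - a u^(2\<theta>): with \<open>s\<close>
  and \<open>t\<close> as consecutive values, the power with exponent 1 - 2\<theta> increases by a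
  fixed amount. If \<open>s \<le> 2 * t\<close>, the mean value theorem applies with an intermediate
  point comparable to \<open>t\<close>; otherwise the ratio of \<open>s\<close> to \<open>t\<close>
  alone makes the negative power jump. The minimum covers both cases.\<close>

lemma powr_increment_of_decrease:
  fixes s t a b \<theta> :: real
  assumes a: "a > 0" and \<theta>: "1 / 2 < \<theta>" and t: "0 < t" "t \<le> s" "s \<le> b"
    and dec: "a * t powr (2 * \<theta>) \<le> s - t"
  shows "min (a * (2 * \<theta> - 1) / 2 powr (2 * \<theta>)) ((2 powr (2 * \<theta> - 1) - 1) * b powr (1 - 2 * \<theta>))
    \<le> t powr (1 - 2 * \<theta>) - s powr (1 - 2 * \<theta>)"
proof (cases "s \<le> 2 * t")
  case True
  have s: "s > 0" using t by simp
  have "t < s"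
  proof -
    have "0 < a * t powr (2 * \<theta>)" using a t by simp
    with dec show ?thesis by linarith
  qed
  have "\<exists>\<xi>>t. \<xi> < s \<and> s powr (1 - 2 * \<theta>) - t powr (1 - 2 * \<theta>)
      = (s - t) * ((1 - 2 * \<theta>) * \<xi> powr (1 - 2 * \<theta> - 1))"
    using t \<open>t < s\<close> by (intro MVT2 has_real_derivative_powr) auto
  then obtain \<xi> where \<xi>: "t < \<xi>" "\<xi> < s" and mvt:
    "s powr (1 - 2 * \<theta>) - t powr (1 - 2 * \<theta>) = (s - t) * ((1 - 2 * \<theta>) * \<xi> powr (1 - 2 * \<theta> - 1))"
    by blast
  have "t powr (1 - 2 * \<theta>) - s powr (1 - 2 * \<theta>)
      = - ((s - t) * ((1 - 2 * \<theta>) * \<xi> powr (1 - 2 * \<theta> - 1)))"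
    unfolding mvt[symmetric] by simp
  also have "\<dots> = (s - t) * ((2 * \<theta> - 1) * \<xi> powr (- 2 * \<theta>))"
    by (simp add: algebra_simps)
  finally have eq: "t powr (1 - 2 * \<theta>) - s powr (1 - 2 * \<theta>)
      = (s - t) * ((2 * \<theta> - 1) * \<xi> powr (- 2 * \<theta>))" .
  \<comment> \<open>Comparability enters here: \<xi> lies below \<open>2 * t\<close> and the
    exponent is negative, at the price of the factor
    \<open>(1 / 2) powr (2 * \<theta>)\<close>.\<close>
  have "(1 / 2) powr (2 * \<theta>) = t powr (2 * \<theta>) * (2 * t) powr (- 2 * \<theta>)"
    using t by (simp add: powr_mult powr_minus_divide powr_divide)
  also have "\<dots> \<le> t powr (2 * \<theta>) * \<xi> powr (- 2 * \<theta>)"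
    using t \<xi> True \<theta> by (intro mult_left_mono powr_mono2') auto
  finally have "a * (2 * \<theta> - 1) * (1 / 2) powr (2 * \<theta>)
      \<le> a * (2 * \<theta> - 1) * (t powr (2 * \<theta>) * \<xi> powr (- 2 * \<theta>))"
    using a \<theta> by (intro mult_left_mono) auto
  also have "\<dots> = (a * t powr (2 * \<theta>)) * ((2 * \<theta> - 1) * \<xi> powr (- 2 * \<theta>))" by simp
  also have "\<dots> \<le> (s - t) * ((2 * \<theta> - 1) * \<xi> powr (- 2 * \<theta>))"
    using dec \<theta> by (intro mult_right_mono) auto
  finally have "a * (2 * \<theta> - 1) / 2 powr (2 * \<theta>) \<le> t powr (1 - 2 * \<theta>) - s powr (1 - 2 * \<theta>)"
    unfolding eq by (simp add: powr_divide)
  then show ?thesis by linarith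
next
  case False
  \<comment> \<open>More than halving the value multiplies its power by at least
    \<open>2 powr (2 * \<theta> - 1)\<close>, which exceeds 1; the resulting gain is bounded below
    through \<open>s \<le> b\<close>.\<close>
  have "2 powr (2 * \<theta> - 1) * s powr (1 - 2 * \<theta>) = (s / 2) powr (1 - 2 * \<theta>)"
    using t by (simp add: powr_divide powr_diff)
  also have "\<dots> \<le> t powr (1 - 2 * \<theta>)"
    using False t \<theta> by (intro powr_mono2') auto
  finally have "(2 powr (2 * \<theta> - 1) - 1) * s powr (1 - 2 * \<theta>) \<le> t powr (1 - 2 * \<theta>) - s powr (1 - 2 * \<theta>)"
    by (simp add: algebra_simps)
  moreover have "(2 powr (2 * \<theta> - 1) - 1) * b powr (1 - 2 * \<theta>)
      \<le> (2 powr (2 * \<theta> - 1) - 1) * s powr (1 - 2 * \<theta>)"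
    using t \<theta> ge_one_powr_ge_zero[of 2 "2 * \<theta> - 1"]
    by (intro mult_left_mono powr_mono2') auto
  ultimately show ?thesis by linarith
qed

text \<open>As long as \<open>E k\<close> is positive, \<open>E k powr (1 - 2 * \<theta>)\<close>
  grows by at least \<mu> per step, hence linearly in \<open>k\<close>; inverting the power gives
  the rate.\<close>

lemma sublinear_rate_of_decrease:
  fixes E :: "nat \<Rightarrow> real"
  assumes a: "a > 0" and \<theta>: "1 / 2 < \<theta>"
    and nonneg: "\<And>k. k \<ge> K \<Longrightarrow> 0 \<le> E k" and pos: "0 < E K"
    and dec: "\<And>k. k \<ge> K \<Longrightarrow> a * E k powr (2 * \<theta>) \<le> E (k - 1) - E k"
  shows "\<exists>\<mu>>0. \<forall>k\<ge>K.
    E k \<le> (1 / (\<mu> * (real k - real K) + E K powr (1 - 2 * \<theta>))) powr (1 / (2 * \<theta> - 1))"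
proof -
  \<comment> \<open>The increment of \<open>powr_increment_of_decrease\<close> for
    \<open>b = E K\<close>, an upper bound for all later values.\<close>
  define \<mu> where "\<mu> = min (a * (2 * \<theta> - 1) / 2 powr (2 * \<theta>))
    ((2 powr (2 * \<theta> - 1) - 1) * E K powr (1 - 2 * \<theta>))"
  have \<mu>: "\<mu> > 0"
    using a \<theta> pos by (auto simp: \<mu>_def)
  have anti: "E (Suc k) \<le> E k" if "k \<ge> K" for k
  proof -
    have "0 \<le> a * E (Suc k) powr (2 * \<theta>)" using a by simp
    with dec[of "Suc k"] that show ?thesis by simp
  qed
  have le: "E k \<le> E K" if "k \<ge> K" for k
    using that by (induction rule: dec_induct) (use anti order_trans in blast)+
  \<comment> \<open>Positivity is required because a vanishing \<open>E k\<close> gives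
    \<open>0 powr (1 - 2 * \<theta>) = 0\<close> and not infinity; it passes to earlier indices by
    monotonicity.\<close>
  have grow: "\<mu> * (real k - real K) + E K powr (1 - 2 * \<theta>) \<le> E k powr (1 - 2 * \<theta>)"
    if "k \<ge> K" "E k > 0" for k
    using that
  proof (induction rule: dec_induct)
    case (step n)
    have "\<mu> \<le> E (Suc n) powr (1 - 2 * \<theta>) - E n powr (1 - 2 * \<theta>)"
      unfolding \<mu>_def using step.prems step.hyps a \<theta> anti[of n] le[of n] dec[of "Suc n"]
      by (intro powr_increment_of_decrease) auto
    moreover have "E n > 0" using step.prems anti[of n] step.hyps by linarith
    ultimately show ?case using step.IH by (simp add: algebra_simps)
  qed simp
  have "E k \<le> (1 / (\<mu> * (real k - real K) + E K powr (1 - 2 * \<theta>))) powr (1 / (2 * \<theta> - 1))"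
    if k: "k \<ge> K" for k
  proof (cases "E k = 0")
    case False
    with nonneg[OF k] have Ek: "E k > 0" by simp
    let ?D = "\<mu> * (real k - real K) + E K powr (1 - 2 * \<theta>)"
    have D: "?D > 0" using \<mu> k pos by (intro add_nonneg_pos) auto
    have "E k powr (2 * \<theta> - 1) = 1 / E k powr (1 - 2 * \<theta>)"
      by (metis minus_diff_eq powr_minus_divide)
    also have "\<dots> \<le> 1 / ?D"
      using grow[OF k Ek] D by (intro divide_left_mono mult_pos_pos) (use Ek in auto)
    finally have "(E k powr (2 * \<theta> - 1)) powr (1 / (2 * \<theta> - 1)) \<le> (1 / ?D) powr (1 / (2 * \<theta> - 1))"
      using \<theta> by (intro powr_mono2) auto
    then show ?thesis using Ek \<theta> by (simp add: powr_powr)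
  qed simp
  with \<mu> show ?thesis by blast
qed

section \<open>Matrix norms and derivative calculus\<close>

lemma inner_transpose_mult_vec: "u \<bullet> (transpose M *v v) = (M *v u) \<bullet> v"
  for M :: "real^'a^'b"
  by (metis dot_lmul_matrix inner_commute transpose_matrix_vector)

lemma norm_mult_vec_le: "norm (M *v v) \<le> opnorm M * norm v"
  for M :: "real^'a^'b"
  by (simp add: onorm)

lemma opnorm_nonneg: "0 \<le> opnorm M"
  for M :: "real^'a^'b"
  by (simp add: onorm_pos_le)

lemma norm_mult_vec_bound:
  fixes M :: "real^'a^'b"
  assumes "opnorm M \<le> C" "norm v \<le> s"
  shows "norm (M *v v) \<le> C * s"
proof -
  have "norm (M *v v) \<le> opnorm M * norm v" by (rule norm_mult_vec_le)
  also have "\<dots> \<le> C * s"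
    using assms opnorm_nonneg[of M] by (intro mult_mono) auto
  finally show ?thesis .
qed

lemma norm_mult_vec_bound2:
  fixes M :: "real^'a^'b" and N :: "real^'c^'a"
  assumes "norm v \<le> s"
  shows "norm (M *v (N *v v)) \<le> opnorm M * opnorm N * s"
  using norm_mult_vec_bound[OF order_refl norm_mult_vec_bound[OF order_refl assms]]
  by (simp add: mult.assoc)

lemma norm_scaleR_bound: "norm v \<le> s \<Longrightarrow> norm (C *\<^sub>R v) \<le> \<bar>C\<bar> * s"
  by (simp add: mult_left_mono)

lemmas matrix_mul_has_derivative [derivative_intros] =
  bounded_linear.has_derivative[OF matrix_vector_mul_bounded_linear]

lemma GDERIV_norm_affine:
  fixes M :: "real^'a^'b"
  shows "GDERIV (\<lambda>u. (norm (M *v u + d))\<^sup>2) v :> 2 *\<^sub>R (transpose M *v (M *v v + d))"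
  unfolding gderiv_def power2_norm_eq_inner
  by (rule derivative_eq_intros refl
      | simp add: inner_transpose_mult_vec inner_commute fun_eq_iff del: transpose_matrix_vector)+

text \<open>The product rule yields two mixed terms, which symmetry of \<open>Q\<close> makes equal,
  so that together they cancel the factor 1/2.\<close>

lemma GDERIV_proximal_term:
  fixes Q :: "real^'a^'a"
  assumes "transpose Q = Q"
  shows "GDERIV (\<lambda>u. p \<bullet> (u - u0) + 1 / 2 * ((u - u0) \<bullet> (Q *v (u - u0)))) v :> p + Q *v (v - u0)"
  unfolding gderiv_def
proof (rule has_derivative_eq_rhs)
  show "((\<lambda>u. p \<bullet> (u - u0) + 1 / 2 * ((u - u0) \<bullet> (Q *v (u - u0)))) has_derivative
    (\<lambda>d. p \<bullet> d + 1 / 2 * ((v - u0) \<bullet> (Q *v d) + d \<bullet> (Q *v (v - u0))))) (at v)"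
    by (rule derivative_eq_intros refl | simp)+
  have "(v - u0) \<bullet> (Q *v d) = d \<bullet> (Q *v (v - u0))" for d
    using inner_transpose_mult_vec[of "v - u0" Q d] assms by (simp add: inner_commute)
  then show "(\<lambda>d. p \<bullet> d + 1 / 2 * ((v - u0) \<bullet> (Q *v d) + d \<bullet> (Q *v (v - u0))))
      = (\<lambda>d. d \<bullet> (p + Q *v (v - u0)))"
    by (simp add: inner_add_right inner_commute)
qed

text \<open>Nesting this with \<open>GDERIV_snd\<close> places the gradient of a function of one
  variable in its slot of the product, with zeros elsewhere.\<close>

lemma GDERIV_fst:
  assumes "GDERIV \<phi> x :> p"
  shows "GDERIV (\<lambda>v. \<phi> (fst v)) (x, y) :> (p, 0)"
proof -
  have "((\<lambda>v. \<phi> (fst v)) has_derivative (\<lambda>d. fst d \<bullet> p)) (at (x, y))"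
    using assms unfolding gderiv_def
    by (intro has_derivative_compose[of fst fst _ _ \<phi>]) (auto intro: has_derivative_fst)
  then show ?thesis by (simp add: gderiv_def inner_prod_def)
qed

lemma GDERIV_snd:
  assumes "GDERIV \<phi> y :> p"
  shows "GDERIV (\<lambda>v. \<phi> (snd v)) (x, y) :> (0, p)"
proof -
  have "((\<lambda>v. \<phi> (snd v)) has_derivative (\<lambda>d. snd d \<bullet> p)) (at (x, y))"
    using assms unfolding gderiv_def
    by (intro has_derivative_compose[of snd snd _ _ \<phi>]) (auto intro: has_derivative_snd)
  then show ?thesis by (simp add: gderiv_def inner_prod_def)
qed

section \<open>The merit function and its subgradients\<close>

text \<open>Everything in the merit function except \<open>f\<close>, kept real-valued so that
  derivatives apply; \<open>a\<close> and \<open>b\<close> stand for \<open>r * \<gamma>\<close> and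
  \<open>r * t\<close>.\<close>

definition merit_smooth where
  "merit_smooth g h A B c \<alpha> a b = (\<lambda>(x, y, z, y', z').
     g x + h y + z \<bullet> (A *v x + B *v y + c) + \<alpha> / 2 * (norm (A *v x + B *v y + c))\<^sup>2
     + (a * (norm (transpose B *v (z - z')))\<^sup>2 + b * (norm (y - y'))\<^sup>2))"

lemma merit_eq:
  "merit f g h A B c \<alpha> r \<gamma> t v
    = f (fst v) + ereal (merit_smooth g h A B c \<alpha> (r * \<gamma>) (r * t) v)"
  by (cases v; cases "f (fst v)")
    (auto simp: merit_def merit_smooth_def aug_lagrangian_def)

text \<open>The five entries are the partial gradients. The last two repeat the quadratic terms with
  opposite sign, since these depend on \<open>y - y'\<close> and \<open>z - z'\<close> only.\<close>

lemma GDERIV_merit_smooth: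
  fixes A :: "real^'n^'p" and B :: "real^'m^'p" and x :: "real^'n" and y y' :: "real^'m" and c z z' :: "real^'p"
  assumes g: "GDERIV g x :> gx" and h: "GDERIV h y :> hy"
  defines "\<rho> \<equiv> A *v x + B *v y + c"
  shows "GDERIV (merit_smooth g h A B c \<alpha> a b) (x, y, z, y', z') :>
    (gx + transpose A *v z + \<alpha> *\<^sub>R (transpose A *v \<rho>),
     hy + transpose B *v z + \<alpha> *\<^sub>R (transpose B *v \<rho>) + (2 * b) *\<^sub>R (y - y'),
     \<rho> + (2 * a) *\<^sub>R (B *v (transpose B *v (z - z'))),
     - (2 * b) *\<^sub>R (y - y'),
     - (2 * a) *\<^sub>R (B *v (transpose B *v (z - z'))))"
proof -
  note g' = GDERIV_fst[OF g, unfolded gderiv_def]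
    and h' = GDERIV_snd[OF GDERIV_fst[OF h], unfolded gderiv_def]
  define u where "u = y - y'"
  have u: "u \<bullet> d + d \<bullet> u = 2 * (d \<bullet> u)" for d
    by (simp add: inner_commute)
  define e where "e = B *v (transpose B *v (z - z'))"
  have e: "(transpose B *v (z - z')) \<bullet> (transpose B *v d) = d \<bullet> e"
    "(transpose B *v d) \<bullet> (transpose B *v (z - z')) = d \<bullet> e" for d
    using inner_transpose_mult_vec[of "transpose B *v (z - z')" B d]
    unfolding e_def by (simp_all only: inner_commute)
  have A: "d \<bullet> (transpose A *v v) = v \<bullet> (A *v d)" for d v
    by (simp only: inner_transpose_mult_vec inner_commute)
  have B: "d \<bullet> (transpose B *v v) = v \<bullet> (B *v d)" for d v
    by (simp only: inner_transpose_mult_vec inner_commute)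
  \<comment> \<open>The derivative is first stated in the shape that the product rule gives on
    projections; afterwards \<open>u\<close> and \<open>e\<close> merge the symmetric terms, and
    \<open>A\<close>, \<open>B\<close> pass to the adjoints.\<close>
  have "((\<lambda>v. g (fst v) + h (fst (snd v))
      + fst (snd (snd v)) \<bullet> (A *v fst v + B *v fst (snd v) + c)
      + \<alpha> / 2 * ((A *v fst v + B *v fst (snd v) + c) \<bullet> (A *v fst v + B *v fst (snd v) + c))
      + (a * ((transpose B *v (fst (snd (snd v)) - snd (snd (snd (snd v)))))
              \<bullet> (transpose B *v (fst (snd (snd v)) - snd (snd (snd (snd v))))))
        + b * ((fst (snd v) - fst (snd (snd (snd v)))) \<bullet> (fst (snd v) - fst (snd (snd (snd v)))))))
    has_derivative (\<lambda>d. fst d \<bullet> gx + fst (snd d) \<bullet> hy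
      + (z \<bullet> (A *v fst d + B *v fst (snd d)) + fst (snd (snd d)) \<bullet> \<rho>)
      + \<alpha> / 2 * (\<rho> \<bullet> (A *v fst d + B *v fst (snd d)) + (A *v fst d + B *v fst (snd d)) \<bullet> \<rho>)
      + (a * ((transpose B *v (z - z')) \<bullet> (transpose B *v (fst (snd (snd d)) - snd (snd (snd (snd d)))))
             + (transpose B *v (fst (snd (snd d)) - snd (snd (snd (snd d))))) \<bullet> (transpose B *v (z - z')))
        + b * ((y - y') \<bullet> (fst (snd d) - fst (snd (snd (snd d))))
             + (fst (snd d) - fst (snd (snd (snd d)))) \<bullet> (y - y')))))
    (at (x, y, z, y', z'))"
    unfolding \<rho>_def
    by (rule derivative_eq_intros g' h' refl | simp add: inner_prod_def)+
  then show ?thesis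
    unfolding gderiv_def merit_smooth_def split_def power2_norm_eq_inner
    unfolding e e_def[symmetric] u_def[symmetric] u
    by (rule has_derivative_eq_rhs)
      (auto simp: fun_eq_iff inner_add_right inner_diff_right inner_diff_left A B
        inner_commute[of _ \<rho>] inner_commute[of _ z] algebra_simps simp del: transpose_matrix_vector)
qed

lemma argmin_setD: "u \<in> argmin_set F \<Longrightarrow> F u \<le> F w" for F :: "'a \<Rightarrow> 'b::linorder"
  by (auto simp: argmin_set_def is_arg_min_def not_less)

text \<open>
  Subtracting the two proximal models \<open>\<phi>\<close> and \<open>\<psi>\<close> from the smooth part of the merit function leaves
  a smooth function that supports the merit function from below at the new iterate; so its gradient
  is a Frechet subgradient, and neither the optimality condition of the \<open>x\<close>-step nor that of the
  \<open>y\<close>-step needs to be written down.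
\<close>

lemma merit_frechet_subgradient:
  fixes f :: "real^'n \<Rightarrow> ereal" and g :: "real^'n \<Rightarrow> real" and h :: "real^'m \<Rightarrow> real"
    and A :: "real^'n^'p" and B :: "real^'m^'p" and c :: "real^'p" and y' :: "real^'m" and z' :: "real^'p"
  assumes fin: "\<bar>f x\<bar> \<noteq> \<infinity>"
    and g: "GDERIV g x :> gx" and h: "GDERIV h y :> hy"
    and \<phi>: "GDERIV \<phi> x :> p" and \<psi>: "GDERIV \<psi> y :> q"
    and minx: "\<And>u. f x + ereal (\<phi> x) \<le> f u + ereal (\<phi> u)"
    and miny: "\<And>v. \<psi> y \<le> \<psi> v"
  defines "\<rho> \<equiv> A *v x + B *v y + c"
  shows "(gx + transpose A *v z + \<alpha> *\<^sub>R (transpose A *v \<rho>) - p,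
     hy + transpose B *v z + \<alpha> *\<^sub>R (transpose B *v \<rho>) + (2 * (r * t)) *\<^sub>R (y - y') - q,
     \<rho> + (2 * (r * \<gamma>)) *\<^sub>R (B *v (transpose B *v (z - z'))),
     - (2 * (r * t)) *\<^sub>R (y - y'),
     - (2 * (r * \<gamma>)) *\<^sub>R (B *v (transpose B *v (z - z'))))
    \<in> frechet_subdiff (merit f g h A B c \<alpha> r \<gamma> t) (x, y, z, y', z')" (is "?w \<in> _")
proof -
  let ?S = "merit_smooth g h A B c \<alpha> (r * \<gamma>) (r * t)"
  let ?G = "\<lambda>v. ?S v - (\<phi> (fst v) + \<psi> (fst (snd v)))"
  let ?v = "(x, y, z, y', z')"
  obtain fx where fx: "f x = ereal fx" using fin by (cases "f x") auto
  show ?thesis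
  proof (rule frechet_subdiffI[where G = ?G])
    show "\<bar>merit f g h A B c \<alpha> r \<gamma> t ?v\<bar> \<noteq> \<infinity>" by (simp add: merit_eq fx)
  next
    have "GDERIV (\<lambda>v. \<phi> (fst v) + \<psi> (fst (snd v))) ?v :> (p, q, 0, 0, 0)"
      using GDERIV_add[OF GDERIV_fst[OF \<phi>] GDERIV_snd[OF GDERIV_fst[OF \<psi>]], of "(z, y', z')"]
      by (simp add: zero_prod_def)
    from GDERIV_diff[OF GDERIV_merit_smooth[OF g h] this]
    show "GDERIV ?G ?v :> ?w" by (simp add: \<rho>_def)
  next
    fix u :: "(real^'n) \<times> (real^'m) \<times> (real^'p) \<times> (real^'m) \<times> (real^'p)"
    have "f (fst u) \<noteq> -\<infinity>" using minx[of "fst u"] fx by auto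
    \<comment> \<open>The smooth part cancels from both sides, and what remains is the sum of
      \<open>minx\<close> and \<open>miny\<close>.\<close>
    then show "merit f g h A B c \<alpha> r \<gamma> t ?v + ereal (?G u - ?G ?v) \<le> merit f g h A B c \<alpha> r \<gamma> t u"
      using minx[of "fst u"] miny[of "fst (snd u)"]
      by (cases "f (fst u)") (auto simp: merit_eq fx)
  qed
qed

lemma norm_add3_diff_le: "norm (a + b + c - d) \<le> norm a + norm b + norm c + norm d"
  for a :: "'a::real_normed_vector"
  using norm_triangle_ineq4[of "a + b + c" d] norm_triangle_ineq[of "a + b" c] norm_triangle_ineq[of a b]
  by linarith

lemma norm_Pair5_le: "norm (a, b, c, d, e) \<le> norm a + norm b + norm c + norm d + norm e"
  using norm_Pair_le[of a "(b, c, d, e)"] norm_Pair_le[of b "(c, d, e)"] norm_Pair_le[of c "(d, e)"]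
    norm_Pair_le[of d e] by linarith

text \<open>Once the models are subtracted, each component involves only differences of consecutive
  iterates: Lipschitz continuity handles the gradients, the multiplier update turns the constraint
  residual into a multiple of the step in \<open>z\<close>, and the matrices are bounded uniformly
  in \<open>k\<close>. Hence one \<open>M\<close> serves all \<open>k\<close>.\<close>

lemma pl_admm_subgradient_bound:
  fixes f :: "real^'n \<Rightarrow> ereal" and g :: "real^'n \<Rightarrow> real" and h :: "real^'m \<Rightarrow> real"
    and A :: "real^'n^'p" and B :: "real^'m^'p"
  assumes alg: "pl_admm f g h A B c \<alpha> \<beta> Q\<^sub>1 Q\<^sub>2 x y z"
    and fin: "\<And>k. \<bar>f (x (Suc k))\<bar> \<noteq> \<infinity>"
    and g: "\<forall>u. g differentiable (at u)" and h: "\<forall>v. h differentiable (at v)"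
    and lip: "L\<^sub>g-lipschitz_on UNIV (grad g)" "L\<^sub>h-lipschitz_on UNIV (grad h)"
    and \<alpha>: "\<alpha> > 0" and \<beta>: "\<beta> > 0"
    and Q: "\<And>k. opnorm (Q\<^sub>1 k) \<le> q\<^sub>1" "\<And>k. opnorm (Q\<^sub>2 k) \<le> q\<^sub>2"
  obtains M where "M > 0" "\<And>k. \<exists>w \<in> frechet_subdiff (merit f g h A B c \<alpha> r \<gamma> t)
      (x (Suc k), y (Suc k), z (Suc k), y k, z k).
    norm w \<le> M * (norm (x (Suc k) - x k) + norm (y (Suc k) - y k) + norm (z (Suc k) - z k))"
proof -
  let ?oA = "opnorm (transpose A)" and ?oB = "opnorm (transpose B)"
  \<comment> \<open>The five groups of summands bound, relative to the step length, the five
    components of the subgradient, which \<open>norm_Pair5_le\<close> adds up.\<close>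
  define M where "M = (L\<^sub>g + ?oA + \<alpha> * (?oA * (opnorm A + opnorm B)) + q\<^sub>1)
    + (L\<^sub>h + ?oB + \<bar>2 * (r * t)\<bar> + q\<^sub>2) + (1 / (\<alpha> * \<beta>) + \<bar>2 * (r * \<gamma>)\<bar> * (opnorm B * ?oB))
    + \<bar>2 * (r * t)\<bar> + \<bar>2 * (r * \<gamma>)\<bar> * (opnorm B * ?oB)"
  have L: "L\<^sub>g \<ge> 0" "L\<^sub>h \<ge> 0" using lip lipschitz_on_nonneg by blast+
  have q: "q\<^sub>1 \<ge> 0" "q\<^sub>2 \<ge> 0" using Q[of 0] opnorm_nonneg[of "Q\<^sub>1 0"] opnorm_nonneg[of "Q\<^sub>2 0"] by linarith+
  have "1 / (\<alpha> * \<beta>) > 0" using \<alpha> \<beta> by simp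
  moreover have "0 \<le> \<alpha> * (?oA * (opnorm A + opnorm B))" "0 \<le> \<bar>2 * (r * \<gamma>)\<bar> * (opnorm B * ?oB)"
    using \<alpha> by (auto intro!: mult_nonneg_nonneg add_nonneg_nonneg opnorm_nonneg)
  ultimately have "M > 0"
    using L q opnorm_nonneg[of "transpose A"] opnorm_nonneg[of "transpose B"]
    unfolding M_def by linarith
  moreover have "\<exists>w \<in> frechet_subdiff (merit f g h A B c \<alpha> r \<gamma> t)
      (x (Suc k), y (Suc k), z (Suc k), y k, z k).
    norm w \<le> M * (norm (x (Suc k) - x k) + norm (y (Suc k) - y k) + norm (z (Suc k) - z k))" for k
  proof -
    let ?x = "x (Suc k)" and ?y = "y (Suc k)" and ?z = "z (Suc k)"
    define \<rho> where "\<rho> = A *v ?x + B *v ?y + c"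
    define dx dy dz where d: "dx = ?x - x k" "dy = ?y - y k" "dz = ?z - z k"
    define s where "s = norm dx + norm dy + norm dz"
    have s: "norm dx \<le> s" "norm dy \<le> s" "norm dz \<le> s" "0 \<le> s"
      by (auto simp: s_def)
    note bd = norm_mult_vec_bound and bd2 = norm_mult_vec_bound2 and sc = norm_scaleR_bound
    define p where "p = grad g (x k) + \<alpha> *\<^sub>R (transpose A *v (A *v x k + B *v y k + c + (1 / \<alpha>) *\<^sub>R z k))"
    define q' where "q' = grad h (y k) + transpose B *v z k"
    define \<phi> where "\<phi> = (\<lambda>u. p \<bullet> (u - x k) + 1 / 2 * ((u - x k) \<bullet> (Q\<^sub>1 k *v (u - x k))))"
    define \<psi> where "\<psi> = (\<lambda>u. q' \<bullet> (u - y k) + \<alpha> / 2 * (norm (B *v u + A *v ?x + c))\<^sup>2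
      + 1 / 2 * ((u - y k) \<bullet> (Q\<^sub>2 k *v (u - y k))))"
    have sym: "transpose (Q\<^sub>1 k) = Q\<^sub>1 k" "transpose (Q\<^sub>2 k) = Q\<^sub>2 k"
      using alg unfolding pl_admm_def sym_psd_def by blast+
    have minx: "?x \<in> argmin_set (\<lambda>u. f u + ereal (\<phi> u))"
      using alg unfolding pl_admm_def \<phi>_def p_def by blast
    have miny: "?y \<in> argmin_set \<psi>"
      using alg unfolding pl_admm_def \<psi>_def q'_def by blast
    have zstep: "dz = (\<alpha> * \<beta>) *\<^sub>R \<rho>"
    proof -
      have "?z = z k + (\<alpha> * \<beta>) *\<^sub>R \<rho>"
        using alg unfolding pl_admm_def \<rho>_def by blast
      then show ?thesis by (simp add: d)
    qed
    have \<phi>': "GDERIV \<phi> ?x :> p + Q\<^sub>1 k *v dx"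
      unfolding \<phi>_def d by (rule GDERIV_proximal_term) (rule sym)
    \<comment> \<open>The \<open>y\<close>-model keeps the exact penalty, so its gradient contains
      \<open>\<alpha> *\<^sub>R (transpose B *v \<rho>)\<close> with the residual at the new
      iterate; this cancels against the augmented term of the merit function in
      \<open>wy\<close>.\<close>
    have \<psi>': "GDERIV \<psi> ?y :> q' + Q\<^sub>2 k *v dy + \<alpha> *\<^sub>R (transpose B *v \<rho>)"
    proof -
      have "GDERIV (\<lambda>u. (q' \<bullet> (u - y k) + 1 / 2 * ((u - y k) \<bullet> (Q\<^sub>2 k *v (u - y k))))
          + \<alpha> / 2 * (norm (B *v u + (A *v ?x + c)))\<^sup>2) ?y :>
        (q' + Q\<^sub>2 k *v (?y - y k)) + ((\<alpha> / 2) *\<^sub>R (2 *\<^sub>R (transpose B *v (B *v ?y + (A *v ?x + c))))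
          + (norm (B *v ?y + (A *v ?x + c)))\<^sup>2 *\<^sub>R 0)"
        by (intro GDERIV_add GDERIV_mult GDERIV_const GDERIV_norm_affine GDERIV_proximal_term sym)
      then show ?thesis by (simp add: \<psi>_def d \<rho>_def algebra_simps)
    qed
    define wx where "wx = grad g ?x - grad g (x k) + transpose A *v dz
        + \<alpha> *\<^sub>R (transpose A *v (A *v dx + B *v dy)) - Q\<^sub>1 k *v dx"
    define wy where "wy = grad h ?y - grad h (y k) + transpose B *v dz + (2 * (r * t)) *\<^sub>R dy - Q\<^sub>2 k *v dy"
    define wz where "wz = (1 / (\<alpha> * \<beta>)) *\<^sub>R dz + (2 * (r * \<gamma>)) *\<^sub>R (B *v (transpose B *v dz))"
    define w where "w = (wx, wy, wz, - (2 * (r * t)) *\<^sub>R dy, - (2 * (r * \<gamma>)) *\<^sub>R (B *v (transpose B *v dz)))"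
    have "(grad g ?x + transpose A *v ?z + \<alpha> *\<^sub>R (transpose A *v \<rho>) - (p + Q\<^sub>1 k *v dx),
     grad h ?y + transpose B *v ?z + \<alpha> *\<^sub>R (transpose B *v \<rho>) + (2 * (r * t)) *\<^sub>R (?y - y k)
       - (q' + Q\<^sub>2 k *v dy + \<alpha> *\<^sub>R (transpose B *v \<rho>)),
     \<rho> + (2 * (r * \<gamma>)) *\<^sub>R (B *v (transpose B *v (?z - z k))),
     - (2 * (r * t)) *\<^sub>R (?y - y k),
     - (2 * (r * \<gamma>)) *\<^sub>R (B *v (transpose B *v (?z - z k))))
      \<in> frechet_subdiff (merit f g h A B c \<alpha> r \<gamma> t) (?x, ?y, ?z, y k, z k)"
      unfolding \<rho>_def
      by (rule merit_frechet_subgradient[OF fin has_gderiv_grad[OF g[rule_format]]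
            has_gderiv_grad[OF h[rule_format]] \<phi>' \<psi>'[unfolded \<rho>_def]
            argmin_setD[OF minx] argmin_setD[OF miny]])
    also have "grad g ?x + transpose A *v ?z + \<alpha> *\<^sub>R (transpose A *v \<rho>) - (p + Q\<^sub>1 k *v dx) = wx"
    proof -
      \<comment> \<open>The \<open>x\<close>-model linearises the penalty at the old iterates, so
        only the change \<open>\<rho> - \<rho>0\<close> of the residual survives, and this is linear
        in the steps \<open>dx\<close> and \<open>dy\<close>.\<close>
      define \<rho>0 where "\<rho>0 = A *v x k + B *v y k + c"
      have "A *v dx + B *v dy = \<rho> - \<rho>0"
        by (simp add: \<rho>_def \<rho>0_def d matrix_vector_mult_diff_distrib)
      moreover have "p = grad g (x k) + \<alpha> *\<^sub>R (transpose A *v \<rho>0) + transpose A *v z k"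
        using \<alpha> by (simp add: p_def matrix_vector_right_distrib matrix_vector_mult_scaleR
            scaleR_add_right del: transpose_matrix_vector flip: \<rho>0_def)
      ultimately show ?thesis
        by (simp add: wx_def d(3) matrix_vector_mult_diff_distrib scaleR_diff_right
            del: transpose_matrix_vector)
    qed
    also have "grad h ?y + transpose B *v ?z + \<alpha> *\<^sub>R (transpose B *v \<rho>) + (2 * (r * t)) *\<^sub>R (?y - y k)
       - (q' + Q\<^sub>2 k *v dy + \<alpha> *\<^sub>R (transpose B *v \<rho>)) = wy"
      by (simp add: wy_def q'_def d matrix_vector_mult_diff_distrib del: transpose_matrix_vector)
    also have "\<rho> + (2 * (r * \<gamma>)) *\<^sub>R (B *v (transpose B *v (?z - z k))) = wz"
      using \<alpha> \<beta> by (simp add: wz_def zstep flip: d)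
    finally have w: "w \<in> frechet_subdiff (merit f g h A B c \<alpha> r \<gamma> t) (?x, ?y, ?z, y k, z k)"
      by (simp add: w_def d)
    have gl: "norm (grad g ?x - grad g (x k)) \<le> L\<^sub>g * s" "norm (grad h ?y - grad h (y k)) \<le> L\<^sub>h * s"
      using lipschitz_onD[OF lip(1), of ?x "x k"] lipschitz_onD[OF lip(2), of ?y "y k"]
        mult_left_mono[OF s(1) L(1)] mult_left_mono[OF s(2) L(2)]
      by (auto simp: dist_norm d)
    have "norm (\<alpha> *\<^sub>R (transpose A *v (A *v dx + B *v dy)))
        \<le> \<alpha> * (norm (transpose A *v (A *v dx)) + norm (transpose A *v (B *v dy)))"
      using \<alpha> norm_triangle_ineq[of "transpose A *v (A *v dx)" "transpose A *v (B *v dy)"]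
      by (simp add: matrix_vector_right_distrib)
    also have "\<dots> \<le> \<alpha> * (?oA * opnorm A * s + ?oA * opnorm B * s)"
      using \<alpha> by (intro mult_left_mono add_mono bd2 s) auto
    also have "\<dots> = \<alpha> * (?oA * (opnorm A + opnorm B)) * s" by (simp add: algebra_simps)
    finally have aug: "norm (\<alpha> *\<^sub>R (transpose A *v (A *v dx + B *v dy)))
      \<le> \<alpha> * (?oA * (opnorm A + opnorm B)) * s" .
    have "norm wx \<le> (L\<^sub>g + ?oA + \<alpha> * (?oA * (opnorm A + opnorm B)) + q\<^sub>1) * s"
      using norm_add3_diff_le[of "grad g ?x - grad g (x k)" "transpose A *v dz"
          "\<alpha> *\<^sub>R (transpose A *v (A *v dx + B *v dy))" "Q\<^sub>1 k *v dx"]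
        gl(1) bd[OF order_refl s(3), of "transpose A"] aug bd[OF Q(1)[of k] s(1)]
      unfolding wx_def distrib_right by linarith
    moreover have "norm wy \<le> (L\<^sub>h + ?oB + \<bar>2 * (r * t)\<bar> + q\<^sub>2) * s"
      using norm_add3_diff_le[of "grad h ?y - grad h (y k)" "transpose B *v dz" "(2 * (r * t)) *\<^sub>R dy" "Q\<^sub>2 k *v dy"]
        gl(2) bd[OF order_refl s(3), of "transpose B"] sc[OF s(2), of "2 * (r * t)"] bd[OF Q(2)[of k] s(2)]
      unfolding wy_def distrib_right by linarith
    moreover have bb: "norm ((2 * (r * \<gamma>)) *\<^sub>R (B *v (transpose B *v dz)))
        \<le> \<bar>2 * (r * \<gamma>)\<bar> * (opnorm B * ?oB) * s"
      using sc[OF bd2[OF s(3), of B "transpose B"], of "2 * (r * \<gamma>)"] by (simp only: mult.assoc)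
    moreover have "norm wz \<le> (1 / (\<alpha> * \<beta>) + \<bar>2 * (r * \<gamma>)\<bar> * (opnorm B * ?oB)) * s"
      using norm_triangle_ineq[of "(1 / (\<alpha> * \<beta>)) *\<^sub>R dz" "(2 * (r * \<gamma>)) *\<^sub>R (B *v (transpose B *v dz))"]
        sc[OF s(3), of "1 / (\<alpha> * \<beta>)"] bb abs_of_pos[of "1 / (\<alpha> * \<beta>)"] \<alpha> \<beta>
      unfolding wz_def distrib_right by simp
    moreover have "norm (- (2 * (r * t)) *\<^sub>R dy) \<le> \<bar>2 * (r * t)\<bar> * s"
      using sc[OF s(2), of "- (2 * (r * t))"] by (simp only: abs_minus_cancel)
    moreover have "norm (- (2 * (r * \<gamma>)) *\<^sub>R (B *v (transpose B *v dz)))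
        \<le> \<bar>2 * (r * \<gamma>)\<bar> * (opnorm B * ?oB) * s"
      using bb by (simp only: norm_minus_cancel scaleR_minus_left)
    ultimately have "norm w \<le> M * s"
      using norm_Pair5_le[of wx wy wz "- (2 * (r * t)) *\<^sub>R dy" "- (2 * (r * \<gamma>)) *\<^sub>R (B *v (transpose B *v dz))"]
      unfolding w_def M_def distrib_right by linarith
    with w show ?thesis unfolding s_def d by blast
  qed
  ultimately show ?thesis by (rule that)
qed

section \<open>Values of \<open>f\<close> along the iterates\<close>

text \<open>Comparison of the minimiser with a point where \<open>f\<close> is finite. The starting
  point \<open>x 0\<close> is arbitrary, hence the index \<open>Suc k\<close>.\<close>

lemma pl_admm_f_finite:
  assumes "proper f" "pl_admm f g h A B c \<alpha> \<beta> Q\<^sub>1 Q\<^sub>2 x y z"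
  shows "\<bar>f (x (Suc k))\<bar> \<noteq> \<infinity>"
proof -
  obtain w where w: "f w \<noteq> \<infinity>" and ninf: "f (x (Suc k)) \<noteq> -\<infinity>"
    using assms(1) by (auto simp: proper_def)
  define \<phi> where "\<phi> u = (grad g (x k) + \<alpha> *\<^sub>R (transpose A *v (A *v x k + B *v y k + c + (1 / \<alpha>) *\<^sub>R z k)))
      \<bullet> (u - x k) + 1 / 2 * ((u - x k) \<bullet> (Q\<^sub>1 k *v (u - x k)))" for u
  have "x (Suc k) \<in> argmin_set (\<lambda>u. f u + ereal (\<phi> u))"
    using assms(2) unfolding pl_admm_def \<phi>_def by blast
  from argmin_setD[OF this, of w] w ninf show ?thesis
    by (cases "f w"; cases "f (x (Suc k))") auto
qed

text \<open>Lower semicontinuity only gives the lower half of the limit. For the upper half, the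
  model terms at the new iterate and at the competitor \<open>xinf\<close> both tend to 0, since
  these points and the centre \<open>x k\<close> share the limit \<open>xinf\<close>.\<close>

lemma pl_admm_f_tendsto:
  fixes f :: "real^'n \<Rightarrow> ereal" and A :: "real^'n^'p" and B :: "real^'m^'p"
  assumes alg: "pl_admm f g h A B c \<alpha> \<beta> Q\<^sub>1 Q\<^sub>2 x y z"
    and lsc: "lower_semicontinuous f" and fin: "\<bar>f xinf\<bar> \<noteq> \<infinity>"
    and lip: "L-lipschitz_on UNIV (grad g)" and Q: "\<And>k. opnorm (Q\<^sub>1 k) \<le> q\<^sub>1"
    and conv: "x \<longlonglongrightarrow> xinf" "y \<longlonglongrightarrow> yinf" "z \<longlonglongrightarrow> zinf"
  shows "(\<lambda>k. f (x k)) \<longlonglongrightarrow> f xinf"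
proof (rule order_tendstoI)
  fix a assume "a < f xinf"
  then show "\<forall>\<^sub>F k in sequentially. a < f (x k)"
    by (rule lsc_eventually_less[OF lsc _ conv(1)])
next
  fix a assume a: "f xinf < a"
  define p where "p k = grad g (x k) + \<alpha> *\<^sub>R (transpose A *v (A *v x k + B *v y k + c + (1 / \<alpha>) *\<^sub>R z k))" for k
  define \<phi> where "\<phi> k u = p k \<bullet> (u - x k) + 1 / 2 * ((u - x k) \<bullet> (Q\<^sub>1 k *v (u - x k)))" for k u
  obtain fl where fl: "f xinf = ereal fl" using fin by (cases "f xinf") auto
  have "isCont (grad g) xinf"
    using lipschitz_on_continuous_on[OF lip] by (simp add: continuous_on_eq_continuous_at)
  then have "(\<lambda>k. grad g (x k)) \<longlonglongrightarrow> grad g xinf"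
    using conv(1) by (rule isCont_tendsto_compose)
  then have p: "p \<longlonglongrightarrow> grad g xinf
      + \<alpha> *\<^sub>R (transpose A *v (A *v xinf + B *v yinf + c + (1 / \<alpha>) *\<^sub>R zinf))"
    unfolding p_def
    by (intro tendsto_intros bounded_linear.tendsto[OF matrix_vector_mul_bounded_linear] conv)
  have x': "(\<lambda>k. x (Suc k)) \<longlonglongrightarrow> xinf" using conv(1) by (rule LIMSEQ_Suc)
  \<comment> \<open>Stated for an arbitrary sequence because it is applied both to the constant
    \<open>xinf\<close> and to the shifted iterates.\<close>
  have \<phi>: "(\<lambda>k. \<phi> k (u k)) \<longlonglongrightarrow> 0" if u: "u \<longlonglongrightarrow> xinf" for u
  proof -
    have d: "(\<lambda>k. u k - x k) \<longlonglongrightarrow> 0" using tendsto_diff[OF u conv(1)] by simp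
    have "norm ((u k - x k) \<bullet> (Q\<^sub>1 k *v (u k - x k))) \<le> norm (u k - x k) * (q\<^sub>1 * norm (u k - x k))" for k
    proof -
      have "norm ((u k - x k) \<bullet> (Q\<^sub>1 k *v (u k - x k))) \<le> norm (u k - x k) * norm (Q\<^sub>1 k *v (u k - x k))"
        unfolding real_norm_def by (rule Cauchy_Schwarz_ineq2)
      also have "\<dots> \<le> norm (u k - x k) * (q\<^sub>1 * norm (u k - x k))"
        using norm_mult_vec_bound[OF Q order_refl] by (intro mult_left_mono) auto
      finally show ?thesis .
    qed
    moreover have "(\<lambda>k. norm (u k - x k) * (q\<^sub>1 * norm (u k - x k))) \<longlonglongrightarrow> 0"
      using tendsto_mult[OF tendsto_norm[OF d] tendsto_mult_left[OF tendsto_norm[OF d], of q\<^sub>1]] by simp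
    ultimately have "(\<lambda>k. (u k - x k) \<bullet> (Q\<^sub>1 k *v (u k - x k))) \<longlonglongrightarrow> 0"
      by (rule Lim_null_comparison[OF always_eventually[OF allI]])
    from tendsto_add[OF tendsto_inner[OF p d] tendsto_mult_left[OF this, of "1 / 2"]]
    show ?thesis by (simp add: \<phi>_def)
  qed
  have le: "f (x (Suc k)) \<le> ereal (fl + (\<phi> k xinf - \<phi> k (x (Suc k))))" for k
  proof -
    have "x (Suc k) \<in> argmin_set (\<lambda>u. f u + ereal (\<phi> k u))"
      using alg unfolding pl_admm_def \<phi>_def p_def by blast
    from argmin_setD[OF this, of xinf] show ?thesis
      by (cases "f (x (Suc k))") (auto simp: fl)
  qed
  have "(\<lambda>k. fl + (\<phi> k xinf - \<phi> k (x (Suc k)))) \<longlonglongrightarrow> fl + (0 - 0)"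
    by (rule tendsto_add[OF tendsto_const tendsto_diff[OF \<phi>[OF tendsto_const] \<phi>[OF x']]])
  then have "(\<lambda>k. ereal (fl + (\<phi> k xinf - \<phi> k (x (Suc k))))) \<longlonglongrightarrow> f xinf"
    by (simp add: fl)
  from order_tendstoD(2)[OF this a]
  have "\<forall>\<^sub>F k in sequentially. f (x (Suc k)) < a"
    by (rule eventually_mono) (rule le_less_trans[OF le])
  then show "\<forall>\<^sub>F k in sequentially. f (x k) < a"
    using eventually_sequentially_Suc[of "\<lambda>k. f (x k) < a"] by simp
qed

lemma merit_smooth_tendsto:
  fixes A :: "real^'n^'p" and B :: "real^'m^'p"
  assumes "\<forall>u. g differentiable (at u)" "\<forall>v. h differentiable (at v)" "V \<longlonglongrightarrow> v"
  shows "(\<lambda>k. merit_smooth g h A B c \<alpha> a b (V k)) \<longlonglongrightarrow> merit_smooth g h A B c \<alpha> a b v"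
proof -
  obtain x y z y' z' where v: "v = (x, y, z, y', z')" by (cases v) auto
  have "isCont (merit_smooth g h A B c \<alpha> a b) v"
    using GDERIV_merit_smooth[OF has_gderiv_grad[OF assms(1)[rule_format]]
        has_gderiv_grad[OF assms(2)[rule_format]]]
    unfolding v gderiv_def by (rule has_derivative_continuous)
  then show ?thesis using assms(3) by (rule isCont_tendsto_compose)
qed

lemma sum_squared_le_three: "(a + b + c)\<^sup>2 \<le> 3 * (a\<^sup>2 + b\<^sup>2 + c\<^sup>2)" for a b c :: real
proof -
  have "3 * (a\<^sup>2 + b\<^sup>2 + c\<^sup>2) - (a + b + c)\<^sup>2 = (a - b)\<^sup>2 + (b - c)\<^sup>2 + (c - a)\<^sup>2"
    by (simp add: power2_eq_square algebra_simps)
  also have "\<dots> \<ge> 0" by simp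
  finally show ?thesis by simp
qed

section \<open>Recursion and rates for the merit values\<close>

theorem theorem3:
  fixes f :: "real^'n \<Rightarrow> ereal" and g :: "real^'n \<Rightarrow> real" and h :: "real^'m \<Rightarrow> real"
    and A :: "real^'n^'p" and B :: "real^'m^'p" and c :: "real^'p"
    and \<alpha> \<beta> r L\<^sub>g L\<^sub>h q\<^sub>2 \<theta>\<^sub>0 \<theta>\<^sub>1 \<gamma>\<^sub>0 \<theta> :: real
    and Q\<^sub>1 :: "nat \<Rightarrow> real^'n^'n" and Q\<^sub>2 :: "nat \<Rightarrow> real^'m^'m"
    and x :: "nat \<Rightarrow> real^'n" and y :: "nat \<Rightarrow> real^'m" and z :: "nat \<Rightarrow> real^'p"
    and xinf :: "real^'n" and yinf :: "real^'m" and zinf :: "real^'p"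
    and R :: "(real^'n) \<times> (real^'m) \<times> (real^'p) \<times> (real^'m) \<times> (real^'p) \<Rightarrow> ereal"
    and Rk :: "nat \<Rightarrow> ereal" and Rinf :: ereal and E :: "nat \<Rightarrow> real"
  assumes f_proper: "proper f"
    and g_diff: "\<forall>u. g differentiable (at u)"
    and h_diff: "\<forall>v. h differentiable (at v)"
    and A1: "lower_semicontinuous f" "coercive f"
    and A2: "coercive (\<lambda>u. ereal (g u))" "bdd_below (range h)"
    and A3: "rank B = CARD('m)" "range ((*v) A) \<subseteq> range ((*v) B)" "c \<in> range ((*v) B)"
    and A4: "L\<^sub>g-lipschitz_on UNIV (grad g)" "L\<^sub>h-lipschitz_on UNIV (grad h)"
    and A5: "\<alpha> > 0" "0 < \<beta>" "\<beta> < 2"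
      "0 \<le> (INF k. opnorm (Q\<^sub>1 k))" "0 \<le> (INF k. opnorm (Q\<^sub>2 k))"
      "bdd_above (range (\<lambda>k. opnorm (Q\<^sub>1 k)))" "bdd_above (range (\<lambda>k. opnorm (Q\<^sub>2 k)))"
    and q2_eq: "q\<^sub>2 = (SUP k. opnorm (Q\<^sub>2 k))"
    and theta0_eq: "\<theta>\<^sub>0 = 2 * \<beta> * (L\<^sub>h + q\<^sub>2)\<^sup>2
                      / (\<alpha> * lambda_plus (transpose B ** B) * (1 - \<bar>1 - \<beta>\<bar>)\<^sup>2)"
    and theta1_eq: "\<theta>\<^sub>1 = 2 * \<beta> * q\<^sub>2\<^sup>2
                      / (\<alpha> * lambda_plus (transpose B ** B) * (1 - \<bar>1 - \<beta>\<bar>)\<^sup>2)"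
    and gamma0_eq: "\<gamma>\<^sub>0 = \<bar>1 - \<beta>\<bar>
                      / (\<alpha> * \<beta> * lambda_plus (transpose B ** B) * (1 - \<bar>1 - \<beta>\<bar>))"
    and r_gt_1: "r > 1"
    and R_eq: "R = merit f g h A B c \<alpha> r \<gamma>\<^sub>0 \<theta>\<^sub>0"
    and Rk_eq: "\<forall>k\<ge>1. Rk k = R (x k, y k, z k, y (k - 1), z (k - 1))"
    and Rinf_eq: "Rinf = R (xinf, yinf, zinf, yinf, zinf)"
    and E_eq: "\<forall>k\<ge>1. E k = real_of_ereal (Rk k - Rinf)"
    and algorithm: "pl_admm f g h A B c \<alpha> \<beta> Q\<^sub>1 Q\<^sub>2 x y z"
    and assumption_2ii:
      "relaxed_sufficient_decrease A B \<alpha> \<beta> L\<^sub>g L\<^sub>h r \<theta>\<^sub>0 \<theta>\<^sub>1 Q\<^sub>1 Q\<^sub>2 x y z Rk"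
    and conv: "x \<longlonglongrightarrow> xinf" "y \<longlonglongrightarrow> yinf" "z \<longlonglongrightarrow> zinf"
    and KL: "KL_with_exponent R (xinf, yinf, zinf, yinf, zinf) \<theta>"
  shows "\<bar>Rinf\<bar> \<noteq> \<infinity> \<and> (\<forall>k\<ge>1. \<bar>Rk k\<bar> \<noteq> \<infinity>) \<and> Rk \<longlonglongrightarrow> Rinf \<and>
    (\<exists>K\<ge>1. \<exists>\<alpha>bar>0.
      (\<forall>k\<ge>K. \<alpha>bar * E k powr (2 * \<theta>) \<le> E (k - 1) - E k) \<and>
      (\<theta> = 0 \<longrightarrow> (\<exists>N. \<forall>k\<ge>N. E k = 0)) \<and>
      (0 < \<theta> \<and> \<theta> \<le> 1 / 2 \<longrightarrow>
        (\<forall>k\<ge>K. if E K = 0 then E k = 0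
          else E k \<le> Max (E ` {1..K}) / (1 + \<alpha>bar * E K powr (2 * \<theta> - 1)) ^ (k - K + 1))) \<and>
      (1 / 2 < \<theta> \<and> \<theta> < 1 \<longrightarrow>
        (\<exists>\<mu>>0. \<forall>k\<ge>K. if E K = 0 then E k = 0
          else E k \<le> (1 / (\<mu> * (real k - real K) + E K powr (1 - 2 * \<theta>)))
                       powr (1 / (2 * \<theta> - 1)))))"
proof -
  let ?S = "merit_smooth g h A B c \<alpha> (r * \<gamma>\<^sub>0) (r * \<theta>\<^sub>0)"
  let ?vinf = "(xinf, yinf, zinf, yinf, zinf)"
  \<comment> \<open>Evaluated at positive indices only; at 0 the truncated subtraction would repeat
    \<open>y 0\<close> and \<open>z 0\<close>.\<close>
  define V where "V k = (x k, y k, z k, y (k - 1), z (k - 1))" for k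
  define s where "s k = norm (x (Suc k) - x k) + norm (y (Suc k) - y k) + norm (z (Suc k) - z k)" for k
  obtain q\<^sub>1 where q1: "\<And>k. opnorm (Q\<^sub>1 k) \<le> q\<^sub>1"
    using A5(6) unfolding bdd_above_def by blast
  have q2: "\<And>k. opnorm (Q\<^sub>2 k) \<le> q\<^sub>2"
    unfolding q2_eq using A5(7) by (intro cSUP_upper) auto
  have ffin: "\<bar>f (x (Suc k))\<bar> \<noteq> \<infinity>" for k
    by (rule pl_admm_f_finite[OF f_proper algorithm])
  have Rk: "Rk (Suc k) = f (x (Suc k)) + ereal (?S (V (Suc k)))" for k
    using Rk_eq by (simp add: R_eq merit_eq V_def)
  have Rinf: "Rinf = f xinf + ereal (?S ?vinf)" by (simp add: Rinf_eq R_eq merit_eq)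
  have Rkfin: "\<bar>Rk k\<bar> \<noteq> \<infinity>" if "k \<ge> 1" for k
    using Rk[of "k - 1"] ffin[of "k - 1"] that by auto
  have V: "(\<lambda>k. V (Suc k)) \<longlonglongrightarrow> ?vinf"
    unfolding V_def diff_Suc_1 by (intro tendsto_Pair conv conv[THEN LIMSEQ_Suc])
  have S: "(\<lambda>k. ?S (V (Suc k))) \<longlonglongrightarrow> ?S ?vinf"
    by (rule merit_smooth_tendsto[OF g_diff h_diff V])
  obtain k\<^sub>0 \<sigma> where k0: "k\<^sub>0 \<ge> 1" and \<sigma>: "\<sigma> > 0" and
    dec: "\<And>k. k \<ge> k\<^sub>0 \<Longrightarrow> Rk (Suc k) + ereal (\<sigma> * ((norm (x (Suc k) - x k))\<^sup>2
      + (norm (y (Suc k) - y k))\<^sup>2 + (norm (z (Suc k) - z k))\<^sup>2)) \<le> Rk k"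
    "\<And>k. k \<ge> k\<^sub>0 \<Longrightarrow> Rk k \<le> Rk k\<^sub>0"
    using assumption_2ii unfolding relaxed_sufficient_decrease_def by auto
  \<comment> \<open>Were \<open>f xinf\<close> infinite, lower semicontinuity would push
    \<open>f (x k)\<close> above every bound while the smooth part converges, although the merit
    values stay below \<open>Rk k\<^sub>0\<close>.\<close>
  have finf: "\<bar>f xinf\<bar> \<noteq> \<infinity>"
  proof -
    obtain \<rho> where \<rho>: "Rk k\<^sub>0 = ereal \<rho>" using Rkfin[OF k0] by (cases "Rk k\<^sub>0") auto
    have "f xinf \<noteq> \<infinity>"
    proof
      assume "f xinf = \<infinity>"
      \<comment> \<open>The threshold and \<open>?S ?vinf - 1\<close>, an eventual lower bound of
        the smooth part, add up to \<open>\<rho>\<close>, the value of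
        \<open>Rk k\<^sub>0\<close>.\<close>
      then have "\<forall>\<^sub>F k in sequentially. ereal (\<rho> - (?S ?vinf - 1)) < f (x (Suc k))"
        by (intro lsc_eventually_less[OF A1(1) _ LIMSEQ_Suc[OF conv(1)]]) simp
      moreover have "\<forall>\<^sub>F k in sequentially. ?S ?vinf - 1 < ?S (V (Suc k))"
        using S by (rule order_tendstoD) simp
      ultimately have "\<forall>\<^sub>F k in sequentially. ereal (\<rho> - (?S ?vinf - 1)) < f (x (Suc k))
          \<and> ?S ?vinf - 1 < ?S (V (Suc k)) \<and> k \<ge> k\<^sub>0"
        using eventually_ge_at_top[of k\<^sub>0] by eventually_elim simp
      then obtain k where k: "ereal (\<rho> - (?S ?vinf - 1)) < f (x (Suc k))"
          "?S ?vinf - 1 < ?S (V (Suc k))" "k \<ge> k\<^sub>0"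
        using eventually_happens'[OF sequentially_bot] by blast
      then show False using dec(2)[of "Suc k"] Rk[of k] ffin[of k] \<rho>
        by (cases "f (x (Suc k))") auto
    qed
    then show ?thesis using f_proper by (auto simp: proper_def)
  qed
  then have Rinffin: "\<bar>Rinf\<bar> \<noteq> \<infinity>" by (auto simp: Rinf)
  have "(\<lambda>k. f (x (Suc k)) + ereal (?S (V (Suc k)))) \<longlonglongrightarrow> f xinf + ereal (?S ?vinf)"
    using S finf LIMSEQ_Suc[OF pl_admm_f_tendsto[OF algorithm A1(1) finf A4(1) q1 conv]]
    by (intro tendsto_add_ereal tendsto_ereal) auto
  then have Rlim: "Rk \<longlonglongrightarrow> Rinf"
    unfolding Rk[symmetric] Rinf[symmetric] by (rule LIMSEQ_imp_Suc)
  obtain \<rho> where \<rho>: "Rinf = ereal \<rho>" using Rinffin by (cases Rinf) auto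
  have RE: "Rk k = ereal (E k + \<rho>)" if "k \<ge> 1" for k
    using Rkfin[OF that] E_eq that \<rho> by (cases "Rk k") auto
  have "(\<lambda>k. Rk (Suc k)) \<longlonglongrightarrow> Rinf" using Rlim by (rule LIMSEQ_Suc)
  then have "(\<lambda>k. E (Suc k) + \<rho>) \<longlonglongrightarrow> \<rho>" by (simp add: RE \<rho>)
  from tendsto_diff[OF this tendsto_const[of \<rho>]] have Elim: "E \<longlonglongrightarrow> 0"
    by (simp add: filterlim_sequentially_Suc)
  have Edec: "E (Suc k) + \<sigma> * ((norm (x (Suc k) - x k))\<^sup>2
      + (norm (y (Suc k) - y k))\<^sup>2 + (norm (z (Suc k) - z k))\<^sup>2) \<le> E k" if "k \<ge> k\<^sub>0" for k
    using dec(1)[OF that] RE[of k] RE[of "Suc k"] that k0 by simp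
  have anti: "E n \<le> E k" if "k \<ge> k\<^sub>0" "n \<ge> k" for k n
    using that(2)
  proof (induction rule: dec_induct)
    case (step n)
    have "0 \<le> \<sigma> * ((norm (x (Suc n) - x n))\<^sup>2 + (norm (y (Suc n) - y n))\<^sup>2 + (norm (z (Suc n) - z n))\<^sup>2)"
      using \<sigma> by simp
    then show ?case using Edec[of n] step that(1) by linarith
  qed simp
  \<comment> \<open>From \<open>k\<^sub>0\<close> on, \<open>E\<close> decreases to its limit 0 and
    so cannot fall below it.\<close>
  have nonneg: "E k \<ge> 0" if "k \<ge> k\<^sub>0" for k
    using Elim anti[OF that] by (intro LIMSEQ_le_const2[of E 0 "E k"]) blast+
  obtain C\<^sub>L \<epsilon> where CL: "C\<^sub>L > 0" and \<epsilon>: "\<epsilon> > 0" and \<theta>: "0 \<le> \<theta>" "\<theta> < 1"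
    and KL': "\<And>v. dist v ?vinf < \<epsilon> \<Longrightarrow>
      ereal_powr \<bar>R v - R ?vinf\<bar> \<theta> \<le> ereal C\<^sub>L * dist_set 0 (limiting_subdiff R v)"
    using KL unfolding KL_with_exponent_def by blast
  obtain M where M: "M > 0" and sub: "\<And>k. \<exists>w \<in> frechet_subdiff (merit f g h A B c \<alpha> r \<gamma>\<^sub>0 \<theta>\<^sub>0)
      (x (Suc k), y (Suc k), z (Suc k), y k, z k). norm w \<le> M * s k"
    unfolding s_def
    by (rule pl_admm_subgradient_bound[OF algorithm ffin g_diff h_diff A4 A5(1,2) q1 q2,
          where r = r and \<gamma> = \<gamma>\<^sub>0 and t = \<theta>\<^sub>0]) (rule that[unfolded s_def])
  have sub': "\<exists>w \<in> limiting_subdiff R (V (Suc k)). norm w \<le> M * s k" for k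
    using sub[of k] frechet_subset_limiting by (fastforce simp: V_def R_eq)
  obtain N where N: "\<And>k. k \<ge> N \<Longrightarrow> dist (V (Suc k)) ?vinf < \<epsilon>"
    using tendstoD[OF V \<epsilon>] by (auto simp: eventually_sequentially)
  \<comment> \<open>Every \<open>k \<ge> K\<close> has a predecessor past \<open>k\<^sub>0\<close>
    and \<open>N\<close>, where decrease and the KL inequality are available; moreover
    \<open>K - 1 \<ge> 1\<close>, so \<open>E (K - 1)\<close> is among the values of the maximum in
    the linear rate.\<close>
  define K where "K = Suc (Suc (max k\<^sub>0 N))"
  \<comment> \<open>The KL inequality and the subgradient bound give
    \<open>E k powr \<theta> \<le> C\<^sub>L * M * s j\<close>; the 3 comes from bounding the square
    of a sum of three step norms, and \<open>\<sigma>\<close> from the sufficient decrease.\<close>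
  define \<alpha>bar where "\<alpha>bar = \<sigma> / (3 * (C\<^sub>L * M)\<^sup>2)"
  have \<alpha>bar: "\<alpha>bar > 0" using \<sigma> CL M by (simp add: \<alpha>bar_def)
  have rec: "\<alpha>bar * E k powr (2 * \<theta>) \<le> E (k - 1) - E k" if k: "k \<ge> K" for k
  proof -
    obtain j where j: "k = Suc j" "j \<ge> k\<^sub>0" "j \<ge> N" using k by (cases k) (auto simp: K_def)
    obtain w where w: "w \<in> limiting_subdiff R (V k)" "norm w \<le> M * s j"
      using sub'[of j] j by auto
    have Ek: "E k \<ge> 0" using j by (intro nonneg) auto
    have "R (V k) = ereal (E k + \<rho>)"
      using RE[of k] Rk_eq j by (simp add: V_def)
    \<comment> \<open>\<open>\<rho>\<close> cancels, and the absolute value drops out because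
      \<open>E k\<close> is nonnegative.\<close>
    then have "ereal (E k powr \<theta>) = ereal_powr \<bar>R (V k) - R ?vinf\<bar> \<theta>"
      using \<rho> Rinf_eq Ek by (simp add: ereal_powr_def)
    also have "\<dots> \<le> ereal C\<^sub>L * dist_set 0 (limiting_subdiff R (V k))"
      using N[OF j(3)] j by (intro KL') simp
    also have "\<dots> \<le> ereal C\<^sub>L * ereal (norm w)"
      using CL dist_set_zero_le[OF w(1)] by (intro ereal_mult_left_mono) auto
    finally have "E k powr \<theta> \<le> C\<^sub>L * norm w" by simp
    also have "\<dots> \<le> C\<^sub>L * M * s j"
      using w(2) CL by (simp add: mult_left_mono mult.assoc)
    \<comment> \<open>Squaring makes the bound quadratic in the step, as the sufficient decrease
      is.\<close>
    finally have "(E k powr \<theta>)\<^sup>2 \<le> (C\<^sub>L * M * s j)\<^sup>2"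
      by (intro power_mono) auto
    then have "E k powr (2 * \<theta>) \<le> (C\<^sub>L * M)\<^sup>2 * (s j)\<^sup>2"
      by (simp only: mult_2 powr_add power_mult_distrib flip: power2_eq_square)
    also have "\<dots> \<le> (C\<^sub>L * M)\<^sup>2 * (3 * ((norm (x k - x j))\<^sup>2 + (norm (y k - y j))\<^sup>2 + (norm (z k - z j))\<^sup>2))"
      unfolding s_def j by (intro mult_left_mono sum_squared_le_three) simp
    finally have "\<alpha>bar * E k powr (2 * \<theta>) \<le> \<alpha>bar * \<dots>"
      using \<alpha>bar by (intro mult_left_mono) auto
    also have "\<dots> = \<sigma> * ((norm (x k - x j))\<^sup>2 + (norm (y k - y j))\<^sup>2 + (norm (z k - z j))\<^sup>2)"
      using CL M by (simp add: \<alpha>bar_def)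
    also have "\<dots> \<le> E (k - 1) - E k" using Edec[OF j(2)] j by simp
    finally show ?thesis .
  qed
  have K: "K \<ge> 2" "K \<ge> k\<^sub>0" by (auto simp: K_def)
  have nonnegK: "E k \<ge> 0" if "k \<ge> K" for k using nonneg K that by simp
  have zero: "E k = 0" if "E K = 0" "k \<ge> K" for k
    using anti[OF K(2) that(2)] nonnegK[OF that(2)] that(1) by simp
  have fin_term: "\<exists>N. \<forall>k\<ge>N. E k = 0" if "\<theta> = 0"
    using rec that by (intro finite_termination_of_decrease[OF \<alpha>bar _ Elim, of K]) simp
  have linear: "E k \<le> Max (E ` {1..K}) / (1 + \<alpha>bar * E K powr (2 * \<theta> - 1)) ^ (k - K + 1)"
    if "\<theta> \<le> 1 / 2" "E K \<noteq> 0" "k \<ge> K" for k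
  proof -
    have "E k \<le> E (K - 1) / (1 + \<alpha>bar * E K powr (2 * \<theta> - 1)) ^ (k - K + 1)"
      using that K nonnegK[of K] by (intro linear_rate_of_decrease[where E = E and K = K, OF \<alpha>bar _ nonnegK _ rec]) auto
    also have "\<dots> \<le> Max (E ` {1..K}) / (1 + \<alpha>bar * E K powr (2 * \<theta> - 1)) ^ (k - K + 1)"
      using K \<alpha>bar by (intro divide_right_mono Max_ge) (auto intro!: zero_le_power add_nonneg_nonneg)
    finally show ?thesis .
  qed
  have sublinear: "\<exists>\<mu>>0. \<forall>k\<ge>K. if E K = 0 then E k = 0
      else E k \<le> (1 / (\<mu> * (real k - real K) + E K powr (1 - 2 * \<theta>))) powr (1 / (2 * \<theta> - 1))"
    if "1 / 2 < \<theta>"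
  proof (cases "E K = 0")
    case True
    \<comment> \<open>All later values vanish, so any positive \<mu> serves.\<close>
    then show ?thesis using zero by (intro exI[of _ 1]) auto
  next
    case False
    then show ?thesis
      using sublinear_rate_of_decrease[where E = E and K = K, OF \<alpha>bar that nonnegK _ rec] nonnegK[of K] by simp
  qed
  show ?thesis
  proof (intro conjI exI[of _ K] exI[of _ \<alpha>bar])
    show "\<theta> = 0 \<longrightarrow> (\<exists>N. \<forall>k\<ge>N. E k = 0)" using fin_term by blast
    show "0 < \<theta> \<and> \<theta> \<le> 1 / 2 \<longrightarrow> (\<forall>k\<ge>K. if E K = 0 then E k = 0
      else E k \<le> Max (E ` {1..K}) / (1 + \<alpha>bar * E K powr (2 * \<theta> - 1)) ^ (k - K + 1))"
      using zero linear by auto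
    show "1 / 2 < \<theta> \<and> \<theta> < 1 \<longrightarrow> (\<exists>\<mu>>0. \<forall>k\<ge>K. if E K = 0 then E k = 0
      else E k \<le> (1 / (\<mu> * (real k - real K) + E K powr (1 - 2 * \<theta>))) powr (1 / (2 * \<theta> - 1)))"
      using sublinear by blast
    show "\<forall>k\<ge>1. \<bar>Rk k\<bar> \<noteq> \<infinity>" using Rkfin by blast
    show "\<forall>k\<ge>K. \<alpha>bar * E k powr (2 * \<theta>) \<le> E (k - 1) - E k" using rec by blast
    show "1 \<le> K" using K by simp
  qed (rule Rinffin Rlim \<alpha>bar)+
qed

end
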